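(* Let $t\in\mathbb{Z}^+$ and let $\mathrm{Alg}$ be a deterministic $(\alpha,\beta,\gamma)$-competitive algorithm for $\mathrm{ASG}_t$ with respect to $(\mu_0,\mu_1)$. Then $\mathrm{Alg}$ is Pareto-optimal with respect to $(\mu_0,\mu_1)$ if and only if (i) $\alpha=t$ and $\beta=\gamma=0$, or (ii) $\alpha<t$, $\beta=t-\alpha$, and $\gamma=1$.
   Context: Online $(1,t)$-Asymmetric String Guessing with Unknown History and Predictions ($\mathrm{ASG}_t$), $t\in\mathbb{Z}^+$: an instance is a triple $I=(x,\hat{x},r)$ where $x,\hat x\in\{0,1\}^n$ and $r=\langle r_1,\dots,r_n\rangle$. Each request $r_i$ is a prompt to irrevocably output a bit $y_i$; together with $r_i$ the prediction bit $\hat{x}_i$ is revealed; $x$ is revealed only after the last request. Cost: $\mathrm{Alg}(I)=\sum_{i=1}^n\big(y_i+t\,x_i(1-y_i)\big)$, and $\mathrm{Opt}(I)=\sum_i x_i$. Error measures: $\mu_0(I)=\sum_{i} x_i(1-\hat{x}_i)$, $\mu_1(I)=\sum_{i} (1-x_i)\hat{x}_i$. An algorithm is $(\alpha,\beta,\gamma)$-competitive with respect to $(\mu_0,\mu_1)$ if there is a constant $\kappa$ such that for all instances $I$, $\mathrm{Alg}(I)\le \alpha\,\mathrm{Opt}(I)+\beta\,\mu_0(I)+\gamma\,\mu_1(I)+\kappa$, with $\alpha,\beta,\gamma\ge0$. An $(\alpha,\beta,\gamma)$-competitive algorithm is Pareto-optimal for a problem if for no $\varepsilon>0$ does there exist an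 $(\alpha-\varepsilon,\beta,\gamma)$-, an $(\alpha,\beta-\varepsilon,\gamma)$-, or an $(\alpha,\beta,\gamma-\varepsilon)$-competitive (deterministic) algorithm for the problem. *)

theory Defs
  imports Complex_Main
begin

text \<open>Bits are booleans. A request carries no information beyond being a prompt.\<close>

datatype request = Prompt

type_synonym asg_instance = "bool list \<times> bool list \<times> request list"

definition asg_instances :: "asg_instance set" where
  "asg_instances = {(x, xh, r). length xh = length x \<and> length r = length x}"

text \<open>A deterministic online algorithm maps what has been revealed so far, namely the requests
  and prediction bits up to and including the current one, to the current output bit. Its own
  earlier outputs are functions of that history. The length of the instance and the string
  \<open>x\<close> are not available to it.\<close>

type_synonym asg_algorithm = "(request \<times> bool) list \<Rightarrow> bool"

definition asg_output :: "asg_algorithm \<Rightarrow> bool list \<Rightarrow> request list \<Rightarrow> nat \<Rightarrow> bool" where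
  "asg_output A xh r i = A (take (Suc i) (zip r xh))"

fun asg_cost :: "nat \<Rightarrow> asg_algorithm \<Rightarrow> asg_instance \<Rightarrow> real" where
  "asg_cost t A (x, xh, r) =
    (\<Sum>i<length x. of_bool (asg_output A xh r i)
       + real t * of_bool (x ! i) * (1 - of_bool (asg_output A xh r i)))"

fun asg_opt :: "asg_instance \<Rightarrow> real" where
  "asg_opt (x, xh, r) = (\<Sum>i<length x. of_bool (x ! i))"

fun mu0 :: "asg_instance \<Rightarrow> real" where
  "mu0 (x, xh, r) = (\<Sum>i<length x. of_bool (x ! i) * (1 - of_bool (xh ! i)))"

fun mu1 :: "asg_instance \<Rightarrow> real" where
  "mu1 (x, xh, r) = (\<Sum>i<length x. (1 - of_bool (x ! i)) * of_bool (xh ! i))"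

definition asg_competitive ::
  "nat \<Rightarrow> (asg_instance \<Rightarrow> real) \<Rightarrow> (asg_instance \<Rightarrow> real) \<Rightarrow>
    real \<Rightarrow> real \<Rightarrow> real \<Rightarrow> asg_algorithm \<Rightarrow> bool" where
  "asg_competitive t \<mu> \<nu> \<alpha> \<beta> \<gamma> A \<longleftrightarrow>
    \<alpha> \<ge> 0 \<and> \<beta> \<ge> 0 \<and> \<gamma> \<ge> 0 \<and>
    (\<exists>\<kappa>::real. \<forall>I\<in>asg_instances.
      asg_cost t A I \<le> \<alpha> * asg_opt I + \<beta> * \<mu> I + \<gamma> * \<nu> I + \<kappa>)"

definition asg_pareto_optimal ::
  "nat \<Rightarrow> (asg_instance \<Rightarrow> real) \<Rightarrow> (asg_instance \<Rightarrow> real) \<Rightarrow>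
    real \<Rightarrow> real \<Rightarrow> real \<Rightarrow> asg_algorithm \<Rightarrow> bool" where
  "asg_pareto_optimal t \<mu> \<nu> \<alpha> \<beta> \<gamma> A \<longleftrightarrow>
    asg_competitive t \<mu> \<nu> \<alpha> \<beta> \<gamma> A \<and>
    (\<forall>\<epsilon>>0. \<not> (\<exists>B. asg_competitive t \<mu> \<nu> (\<alpha> - \<epsilon>) \<beta> \<gamma> B) \<and>
            \<not> (\<exists>B. asg_competitive t \<mu> \<nu> \<alpha> (\<beta> - \<epsilon>) \<gamma> B) \<and>
            \<not> (\<exists>B. asg_competitive t \<mu> \<nu> \<alpha> \<beta> (\<gamma> - \<epsilon>) B))"

end

theory Submission
  imports Defs
begin

text \<open>Some algorithm is \<open>(\<alpha>, \<beta>, \<gamma>)\<close>-competitive exactly if \<open>\<alpha> \<ge> 1\<close>, \<open>\<beta>, \<gamma> \<ge> 0\<close>,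
  \<open>\<alpha> + \<beta> \<ge> t\<close>, and \<open>\<alpha> \<ge> t\<close> or \<open>\<gamma> \<ge> 1\<close>; the Pareto-optimal points are the coordinatewise
  minimal points of this region. Attainability is witnessed by the algorithm that always answers 0
  (if \<open>\<alpha> \<ge> t\<close>) and by the one that follows the predictions (if \<open>\<gamma> \<ge> 1\<close>).
  For necessity the predictions are constant, so the answers are a fixed sequence \<open>y\<close> that does not
  depend on \<open>x\<close>. If all predictions are 0, weighting \<open>x = 0\<dots>0\<close> by \<open>t\<close> and \<open>x = 1\<dots>1\<close> by 1 gives
  a cost of at least \<open>t\<close> per round, whatever \<open>y\<close> is, against a bound of \<open>\<alpha> + \<beta>\<close>. If all
  predictions are 1, making \<open>x\<close> all 1 forces \<open>\<alpha> \<ge> 1\<close>, and taking for \<open>x\<close> the complement of \<open>y\<close>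
  loses at least \<open>t - \<alpha>\<close> or \<open>1 - \<gamma>\<close> in every round.\<close>

definition asg_prefix :: "(nat \<Rightarrow> bool) \<Rightarrow> (nat \<Rightarrow> bool) \<Rightarrow> nat \<Rightarrow> asg_instance" where
  "asg_prefix x xh n = (map x [0..<n], map xh [0..<n], replicate n Prompt)"

definition asg_answer :: "asg_algorithm \<Rightarrow> (nat \<Rightarrow> bool) \<Rightarrow> nat \<Rightarrow> bool" where
  "asg_answer A xh i = A (map (\<lambda>j. (Prompt, xh j)) [0..<Suc i])"

definition asg_excess :: "real \<Rightarrow> real \<Rightarrow> real \<Rightarrow> real \<Rightarrow> bool \<Rightarrow> bool \<Rightarrow> bool \<Rightarrow> real" where
  "asg_excess t \<alpha> \<beta> \<gamma> x xh y =
    (if y then 1 else if x then t else 0) -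
    (if x then \<alpha> + (if xh then 0 else \<beta>) else if xh then \<gamma> else 0)"

lemma asg_instances_eq_prefixes: "asg_instances = {asg_prefix x xh n | x xh n. True}"
proof (intro set_eqI iffI)
  fix I
  assume "I \<in> asg_instances"
  then obtain x xh r where I: "I = (x, xh, r)" and len: "length xh = length x" "length r = length x"
    by (auto simp: asg_instances_def)
  have "r = replicate (length x) Prompt"
    using len(2) by (rule replicate_eqI) (rule request.exhaust)
  moreover have "map ((!) xh) [0..<length x] = xh"
    using map_nth[of xh] len by simp
  ultimately have "I = asg_prefix ((!) x) ((!) xh) (length x)"
    by (simp add: I asg_prefix_def map_nth)
  then show "I \<in> {asg_prefix x xh n | x xh n. True}"
    by blast
qed (auto simp: asg_instances_def asg_prefix_def)

lemma asg_output_prefix: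
  assumes "i < n"
  shows "asg_output A (map xh [0..<n]) (replicate n Prompt) i = asg_answer A xh i"
proof -
  have "zip (replicate n Prompt) (map xh [0..<n]) = map (\<lambda>j. (Prompt, xh j)) [0..<n]"
    by (intro nth_equalityI) auto
  with assms show ?thesis
    by (simp add: asg_output_def asg_answer_def take_map del: upt_Suc)
qed

lemma asg_cost_prefix_minus_bound:
  "asg_cost t A (asg_prefix x xh n) -
    (\<alpha> * asg_opt (asg_prefix x xh n) + \<beta> * mu0 (asg_prefix x xh n) + \<gamma> * mu1 (asg_prefix x xh n)) =
    (\<Sum>i<n. asg_excess t \<alpha> \<beta> \<gamma> (x i) (xh i) (asg_answer A xh i))"
  unfolding asg_prefix_def asg_cost.simps asg_opt.simps mu0.simps mu1.simps sum_distrib_left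
    sum.distrib[symmetric] sum_subtractf[symmetric]
  by (intro sum.cong) (auto simp: asg_output_prefix asg_excess_def)

lemma asg_competitive_iff_excess_bounded:
  "asg_competitive t mu0 mu1 \<alpha> \<beta> \<gamma> A \<longleftrightarrow>
    0 \<le> \<alpha> \<and> 0 \<le> \<beta> \<and> 0 \<le> \<gamma> \<and>
    (\<exists>\<kappa>. \<forall>x xh n. (\<Sum>i<n. asg_excess t \<alpha> \<beta> \<gamma> (x i) (xh i) (asg_answer A xh i)) \<le> \<kappa>)"
proof -
  have ball_instances: "(\<forall>I\<in>asg_instances. P I) \<longleftrightarrow> (\<forall>x xh n. P (asg_prefix x xh n))" for P
    unfolding asg_instances_eq_prefixes by blast
  have cost_le_iff: "asg_cost t A (asg_prefix x xh n) \<le> \<alpha> * asg_opt (asg_prefix x xh n)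
      + \<beta> * mu0 (asg_prefix x xh n) + \<gamma> * mu1 (asg_prefix x xh n) + \<kappa> \<longleftrightarrow>
    (\<Sum>i<n. asg_excess t \<alpha> \<beta> \<gamma> (x i) (xh i) (asg_answer A xh i)) \<le> \<kappa>" for x xh n \<kappa>
    unfolding asg_cost_prefix_minus_bound[symmetric] by linarith
  show ?thesis
    unfolding asg_competitive_def ball_instances cost_le_iff ..
qed

lemma asg_competitive_if_excess_nonpos:
  assumes "0 \<le> \<alpha>" "0 \<le> \<beta>" "0 \<le> \<gamma>"
    and "\<And>b xh i. asg_excess t \<alpha> \<beta> \<gamma> b (xh i) (asg_answer A xh i) \<le> 0"
  shows "asg_competitive t mu0 mu1 \<alpha> \<beta> \<gamma> A"
  unfolding asg_competitive_iff_excess_bounded using assms by (meson sum_nonpos)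

lemma asg_competitive_always_zero:
  assumes "real t \<le> \<alpha>" "0 \<le> \<beta>" "0 \<le> \<gamma>"
  shows "asg_competitive t mu0 mu1 \<alpha> \<beta> \<gamma> (\<lambda>_. False)"
proof (rule asg_competitive_if_excess_nonpos)
  show "0 \<le> \<alpha>"
    using assms(1) of_nat_0_le_iff order_trans by blast
  then show "asg_excess t \<alpha> \<beta> \<gamma> b (xh i) (asg_answer (\<lambda>_. False) xh i) \<le> 0" for b xh i
    using assms by (simp add: asg_excess_def asg_answer_def)
qed (use assms in auto)

lemma asg_competitive_follow_prediction:
  assumes "1 \<le> \<alpha>" "0 \<le> \<beta>" "1 \<le> \<gamma>" "real t \<le> \<alpha> + \<beta>"
  shows "asg_competitive t mu0 mu1 \<alpha> \<beta> \<gamma> (\<lambda>h. snd (last h))"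
proof (rule asg_competitive_if_excess_nonpos)
  have "asg_answer (\<lambda>h. snd (last h)) xh i = xh i" for xh i
    by (simp add: asg_answer_def)
  then show "asg_excess t \<alpha> \<beta> \<gamma> b (xh i) (asg_answer (\<lambda>h. snd (last h)) xh i) \<le> 0" for b xh i
    using assms by (simp add: asg_excess_def)
qed (use assms in auto)

lemma linear_bounded_imp_nonpos:
  fixes c \<kappa> :: "'a::archimedean_field"
  assumes "\<And>n. of_nat n * c \<le> \<kappa>"
  shows "c \<le> 0"
proof (rule ccontr)
  assume "\<not> c \<le> 0"
  then obtain n where "\<kappa> < of_nat n * c"
    using ex_less_of_nat_mult[of c \<kappa>] by auto
  with assms[of n] show False
    by simp
qed

text \<open>As in Yao's principle, hidden strings may be averaged, since the answers depend only on the
  predictions.\<close>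

lemma asg_competitive_imp_mixture_excess_nonpos:
  fixes x :: "'k \<Rightarrow> nat \<Rightarrow> bool" and w :: "'k \<Rightarrow> real"
  assumes "asg_competitive t mu0 mu1 \<alpha> \<beta> \<gamma> A"
    and weight_nonneg: "\<And>k. k \<in> K \<Longrightarrow> 0 \<le> w k"
    and excess_ge:
      "\<And>i. c \<le> (\<Sum>k\<in>K. w k * asg_excess t \<alpha> \<beta> \<gamma> (x k i) (xh i) (asg_answer A xh i))"
  shows "c \<le> 0"
proof -
  obtain \<kappa> where excess_le:
    "\<And>x n. (\<Sum>i<n. asg_excess t \<alpha> \<beta> \<gamma> (x i) (xh i) (asg_answer A xh i)) \<le> \<kappa>"
    using assms(1) unfolding asg_competitive_iff_excess_bounded by blast
  have "real n * c \<le> (\<Sum>k\<in>K. w k * \<kappa>)" for n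
  proof -
    have "real n * c = (\<Sum>i<n. c)"
      by simp
    also have "\<dots> \<le> (\<Sum>i<n. \<Sum>k\<in>K. w k * asg_excess t \<alpha> \<beta> \<gamma> (x k i) (xh i) (asg_answer A xh i))"
      by (intro sum_mono excess_ge)
    also have "\<dots> = (\<Sum>k\<in>K. w k * (\<Sum>i<n. asg_excess t \<alpha> \<beta> \<gamma> (x k i) (xh i) (asg_answer A xh i)))"
      by (subst sum.swap) (simp add: sum_distrib_left)
    also have "\<dots> \<le> (\<Sum>k\<in>K. w k * \<kappa>)"
      by (intro sum_mono mult_left_mono excess_le weight_nonneg)
    finally show ?thesis .
  qed
  then show ?thesis
    by (rule linear_bounded_imp_nonpos)
qed

lemma asg_competitive_imp_excess_nonpos:
  assumes "asg_competitive t mu0 mu1 \<alpha> \<beta> \<gamma> A"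
    and "\<And>i. c \<le> asg_excess t \<alpha> \<beta> \<gamma> (x i) (xh i) (asg_answer A xh i)"
  shows "c \<le> 0"
  using asg_competitive_imp_mixture_excess_nonpos[OF assms(1), where K = "{()}" and w = "\<lambda>_. 1"
      and x = "\<lambda>_. x" and xh = xh and c = c] assms(2) by simp

lemma asg_competitive_imp_opt_coeff_add_mu0_coeff_ge:
  assumes "asg_competitive t mu0 mu1 \<alpha> \<beta> \<gamma> A"
  shows "real t \<le> \<alpha> + \<beta>"
proof -
  have "real t - (\<alpha> + \<beta>) \<le> (\<Sum>b\<in>UNIV. (if b then 1 else real t) *
      asg_excess t \<alpha> \<beta> \<gamma> b False (asg_answer A (\<lambda>_. False) i))" for i
    by (simp add: UNIV_bool asg_excess_def)
  then have "real t - (\<alpha> + \<beta>) \<le> 0"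
    by (intro asg_competitive_imp_mixture_excess_nonpos[OF assms, where x = "\<lambda>b _. b"
        and xh = "\<lambda>_. False" and w = "\<lambda>b. if b then 1 else real t"]) auto
  then show ?thesis
    by simp
qed

lemma asg_competitive_imp_opt_coeff_ge_1:
  assumes "t > 0" "asg_competitive t mu0 mu1 \<alpha> \<beta> \<gamma> A"
  shows "1 \<le> \<alpha>"
proof -
  have "1 - \<alpha> \<le> asg_excess t \<alpha> \<beta> \<gamma> True True (asg_answer A (\<lambda>_. True) i)" for i
    using assms(1) by (simp add: asg_excess_def)
  then have "1 - \<alpha> \<le> 0"
    by (rule asg_competitive_imp_excess_nonpos[OF assms(2)])
  then show ?thesis
    by simp
qed

lemma asg_competitive_imp_opt_coeff_ge_or_mu1_coeff_ge_1:
  assumes "asg_competitive t mu0 mu1 \<alpha> \<beta> \<gamma> A"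
  shows "real t \<le> \<alpha> \<or> 1 \<le> \<gamma>"
proof -
  let ?y = "asg_answer A (\<lambda>_. True)"
  have "min (real t - \<alpha>) (1 - \<gamma>) \<le> asg_excess t \<alpha> \<beta> \<gamma> (\<not> ?y i) True (?y i)" for i
    by (simp add: asg_excess_def)
  then have "min (real t - \<alpha>) (1 - \<gamma>) \<le> 0"
    by (rule asg_competitive_imp_excess_nonpos[OF assms])
  then show ?thesis
    by linarith
qed

definition asg_region :: "real \<Rightarrow> (real \<times> real \<times> real) set" where
  "asg_region t = {(\<alpha>, \<beta>, \<gamma>). 1 \<le> \<alpha> \<and> 0 \<le> \<beta> \<and> 0 \<le> \<gamma> \<and> t \<le> \<alpha> + \<beta> \<and> (t \<le> \<alpha> \<or> 1 \<le> \<gamma>)}"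

lemma ex_asg_competitive_iff:
  assumes "t > 0"
  shows "(\<exists>A. asg_competitive t mu0 mu1 \<alpha> \<beta> \<gamma> A) \<longleftrightarrow> (\<alpha>, \<beta>, \<gamma>) \<in> asg_region t"
proof
  assume "\<exists>A. asg_competitive t mu0 mu1 \<alpha> \<beta> \<gamma> A"
  then obtain A where competitive: "asg_competitive t mu0 mu1 \<alpha> \<beta> \<gamma> A" ..
  then have "0 \<le> \<beta>" "0 \<le> \<gamma>"
    by (simp_all add: asg_competitive_def)
  then show "(\<alpha>, \<beta>, \<gamma>) \<in> asg_region t"
    using asg_competitive_imp_opt_coeff_ge_1[OF assms competitive]
      asg_competitive_imp_opt_coeff_add_mu0_coeff_ge[OF competitive]
      asg_competitive_imp_opt_coeff_ge_or_mu1_coeff_ge_1[OF competitive]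
    by (simp add: asg_region_def)
next
  assume "(\<alpha>, \<beta>, \<gamma>) \<in> asg_region t"
  then show "\<exists>A. asg_competitive t mu0 mu1 \<alpha> \<beta> \<gamma> A"
    unfolding asg_region_def
    using asg_competitive_always_zero asg_competitive_follow_prediction by blast
qed

lemma asg_region_minimal_iff:
  assumes "1 \<le> t" "(\<alpha>, \<beta>, \<gamma>) \<in> asg_region t"
  shows "(\<forall>\<epsilon>>0. (\<alpha> - \<epsilon>, \<beta>, \<gamma>) \<notin> asg_region t \<and> (\<alpha>, \<beta> - \<epsilon>, \<gamma>) \<notin> asg_region t \<and>
      (\<alpha>, \<beta>, \<gamma> - \<epsilon>) \<notin> asg_region t) \<longleftrightarrow>
    (\<alpha> = t \<and> \<beta> = 0 \<and> \<gamma> = 0) \<or> (\<alpha> < t \<and> \<beta> = t - \<alpha> \<and> \<gamma> = 1)"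
    (is "?minimal \<longleftrightarrow> ?vertex \<or> ?segment")
proof
  assume minimal: ?minimal
  have opt_coeff_minimal: "\<epsilon> \<le> 0" if "(\<alpha> - \<epsilon>, \<beta>, \<gamma>) \<in> asg_region t" for \<epsilon>
    using minimal that not_le by blast
  have mu0_coeff_minimal: "\<epsilon> \<le> 0" if "(\<alpha>, \<beta> - \<epsilon>, \<gamma>) \<in> asg_region t" for \<epsilon>
    using minimal that not_le by blast
  have mu1_coeff_minimal: "\<epsilon> \<le> 0" if "(\<alpha>, \<beta>, \<gamma> - \<epsilon>) \<in> asg_region t" for \<epsilon>
    using minimal that not_le by blast
  have region: "1 \<le> \<alpha>" "0 \<le> \<beta>" "0 \<le> \<gamma>" "t \<le> \<alpha> + \<beta>" "t \<le> \<alpha> \<or> 1 \<le> \<gamma>"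
    using assms(2) by (simp_all add: asg_region_def)
  show "?vertex \<or> ?segment"
  proof (cases "t \<le> \<alpha>")
    case True
    have "\<alpha> - t \<le> 0"
      using region assms(1) by (intro opt_coeff_minimal) (simp add: asg_region_def)
    moreover have "\<beta> \<le> 0"
      using region True by (intro mu0_coeff_minimal) (simp add: asg_region_def)
    moreover have "\<gamma> \<le> 0"
      using region True by (intro mu1_coeff_minimal) (simp add: asg_region_def)
    ultimately show ?thesis
      using True region by linarith
  next
    case False
    have "\<beta> - (t - \<alpha>) \<le> 0"
      using region False by (intro mu0_coeff_minimal) (simp add: asg_region_def)
    moreover have "\<gamma> - 1 \<le> 0"
      using region False by (intro mu1_coeff_minimal) (simp add: asg_region_def)
    ultimately show ?thesis
      using False region by linarith
  qed
next
  assume "?vertex \<or> ?segment"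
  then show ?minimal
    by (auto simp: asg_region_def)
qed

theorem theorem13:
  fixes t :: nat and \<alpha> \<beta> \<gamma> :: real and A :: asg_algorithm
  assumes "t > 0"
    and "asg_competitive t mu0 mu1 \<alpha> \<beta> \<gamma> A"
  shows "asg_pareto_optimal t mu0 mu1 \<alpha> \<beta> \<gamma> A \<longleftrightarrow>
    (\<alpha> = real t \<and> \<beta> = 0 \<and> \<gamma> = 0) \<or>
    (\<alpha> < real t \<and> \<beta> = real t - \<alpha> \<and> \<gamma> = 1)"
proof -
  have "asg_pareto_optimal t mu0 mu1 \<alpha> \<beta> \<gamma> A \<longleftrightarrow>
      (\<forall>\<epsilon>>0. (\<alpha> - \<epsilon>, \<beta>, \<gamma>) \<notin> asg_region t \<and> (\<alpha>, \<beta> - \<epsilon>, \<gamma>) \<notin> asg_region t \<and>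
        (\<alpha>, \<beta>, \<gamma> - \<epsilon>) \<notin> asg_region t)"
    using assms(2) by (simp add: asg_pareto_optimal_def ex_asg_competitive_iff[OF assms(1)])
  moreover have "(\<alpha>, \<beta>, \<gamma>) \<in> asg_region t"
    using assms ex_asg_competitive_iff by blast
  moreover have "1 \<le> real t"
    using assms(1) by simp
  ultimately show ?thesis
    by (simp only: asg_region_minimal_iff)
qed

end
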